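(* For every finite subgroup $G$ of $GL_2(\mathbb{Z})$ there exists a Kähler–Einstein Fano polygon $P$ such that $Aut(P)$ is isomorphic to $G$.
   Context: A Fano polygon $P\subset\mathbb{R}^2$ is a two-dimensional convex lattice polygon (with respect to $\mathbb{Z}^2$) whose vertices are primitive lattice points and which contains the origin in its interior. $Aut(P)$ is the group of all elements of $GL_2(\mathbb{Z})$ preserving $P$. The dual polygon is $P^*=\{w\in\mathbb{R}^2 : \langle w,v\rangle\geq -1 \text{ for every } v\in P\}$, and $P$ is Kähler–Einstein if the barycenter of $P^*$ is the origin. *)

theory Defs
  imports "HOL-Analysis.Analysis" "HOL-Algebra.Group"
begin

definition GL2Z :: "(int^2^2) monoid" where
  "GL2Z = \<lparr>carrier = {A. invertible A}, mult = (**), one = mat 1\<rparr>"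

lemma group_GL2Z: "group GL2Z"
proof (rule groupI)
  fix A assume "A \<in> carrier GL2Z"
  then obtain B where "A ** B = mat 1" "B ** A = mat 1"
    by (auto simp: GL2Z_def invertible_def)
  then show "\<exists>B \<in> carrier GL2Z. B \<otimes>\<^bsub>GL2Z\<^esub> A = \<one>\<^bsub>GL2Z\<^esub>"
    by (auto simp: GL2Z_def invertible_def)
qed (auto simp: GL2Z_def invertible_mult matrix_mul_assoc intro: invertible_def[THEN iffD2])

definition GL2Z_act :: "int^2^2 \<Rightarrow> real^2 \<Rightarrow> real^2" where
  "GL2Z_act A x = map_matrix of_int A *v x"

definition primitive_lattice_point :: "real^2 \<Rightarrow> bool" where
  "primitive_lattice_point v \<longleftrightarrow>
     (\<exists>a b :: int. v = vector [of_int a, of_int b] \<and> coprime a b)"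

definition Fano_polygon :: "(real^2) set \<Rightarrow> bool" where
  "Fano_polygon P \<longleftrightarrow>
     polytope P \<and> aff_dim P = 2 \<and>
     (\<forall>v. v extreme_point_of P \<longrightarrow> primitive_lattice_point v) \<and>
     0 \<in> interior P"

definition Aut_polygon :: "(real^2) set \<Rightarrow> (int^2^2) set" where
  "Aut_polygon P = {A \<in> carrier GL2Z. GL2Z_act A ` P = P}"

definition dual_polygon :: "(real^2) set \<Rightarrow> (real^2) set" where
  "dual_polygon P = {w. \<forall>v\<in>P. w \<bullet> v \<ge> -1}"

text \<open>For a Fano polygon the dual is a compact convex set with nonempty interior, so the
  integral below exists and the area is positive; the values the totalised integral and
  division take in degenerate cases play no role.\<close>

definition barycenter :: "(real^2) set \<Rightarrow> real^2" where
  "barycenter S = (1 / measure lborel S) *\<^sub>R (LINT x:S|lborel. x)"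

definition Kaehler_Einstein :: "(real^2) set \<Rightarrow> bool" where
  "Kaehler_Einstein P \<longleftrightarrow> barycenter (dual_polygon P) = 0"

end

theory Submission
  imports Defs
begin

text \<open>Up to isomorphism, a finite subgroup \<open>G\<close> of \<open>GL\<^sub>2(\<int>)\<close> is known from two pieces of data. Its
elements of determinant 1, the rotations, form a cyclic group, of order 1, 2, 3, 4 or 6; the order
is encoded by the trace 2, -2, -1, 0 or 1 of a generator (\<open>rotation_subgroup\<close>). An element of
determinant \<open>-1\<close>, a reflection, is an involution that inverts every rotation. So \<open>G\<close> is a cyclic
group, or its extension by an inverting involution, and its multiplication table depends only on
the trace of the generating rotation and on the existence of a reflection
(\<open>isomorphic_of_same_type\<close>). Cyclicity is proved without diagonalization: two rotations of order
at least 3 satisfy a reversed Cauchy--Schwarz inequality between traces, which is so restrictive,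
as all traces are integers between -2 and 2, that they must agree up to sign and inversion
(\<open>elliptic_unique\<close>).

It remains to find Kaehler--Einstein polygons for the ten possible combinations
(\<open>all_symmetry_types_realized\<close>). The barycenter condition is invariant under real linear maps,
whereas the automorphism group is sensitive to the lattice. The standard triangle with vertices
\<open>(1, 0)\<close>, \<open>(0, 1)\<close>, \<open>(-1, -1)\<close>, the square with vertices \<open>(\<plusminus>1, 0)\<close>, \<open>(0, \<plusminus>1)\<close> and the hexagon
spanned by the triangle and its negative are Kaehler--Einstein because each has a linear symmetry
fixing only the origin, and this symmetry, though no longer integral, survives any real linear
change of coordinates (\<open>Kaehler_Einstein_if_symmetry\<close>). Sending \<open>(0, 1)\<close> to a lattice vector \<open>(a,
b)\<close> deforms these polygons into Fano polygons whose integral symmetries are controlled by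
divisibility conditions on \<open>a\<close> and \<open>b\<close>. Suitable choices leave any prescribed part of the
symmetry: the triangle has rotation groups of order 1 and 3, the parallelogram 2 and 4, the
hexagon 6, each with or without reflections. In particular the triangle with vertices \<open>(1, 0)\<close>,
\<open>(2, 11)\<close>, \<open>(-3, -11)\<close> realizes the trivial group.\<close>

section \<open>Integral two-by-two matrices\<close>
lemmas matrix2 = vec_eq_iff forall_2 matrix_matrix_mult_def sum_2 det_2 trace_def mat_def

lemma GL2Z_simps [simp]:
  "x \<otimes>\<^bsub>GL2Z\<^esub> y = x ** y" "\<one>\<^bsub>GL2Z\<^esub> = mat 1"
  by (simp_all add: GL2Z_def)

definition adjugate :: "int^2^2 \<Rightarrow> int^2^2" where
  "adjugate A = vector [vector [A$2$2, - (A$1$2)], vector [- (A$2$1), A$1$1]]"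

lemma adjugate_mult:
  "A ** adjugate A = mat (det A)" "adjugate A ** A = mat (det A)"
  by (simp_all add: adjugate_def matrix2 algebra_simps)

lemma carrier_GL2Z: "A \<in> carrier GL2Z \<longleftrightarrow> det A = 1 \<or> det A = -1"
proof
  assume "A \<in> carrier GL2Z"
  then obtain B where "A ** B = mat 1"
    by (auto simp: GL2Z_def invertible_def)
  then have "det A * det B = 1" by (metis det_mul det_I)
  then show "det A = 1 \<or> det A = -1" by (auto simp: zmult_eq_1_iff)
next
  assume *: "det A = 1 \<or> det A = -1"
  define B where "B = mat (det A) ** adjugate A"
  have "A ** B = mat 1" "B ** A = mat 1"
  proof -
    have "A ** (mat k ** C) = mat k ** (A ** C)" for k :: int and C
      by (simp add: matrix2 algebra_simps)
    moreover have "mat (det A) ** mat (det A) = (mat 1 :: int^2^2)"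
      using * by (auto simp: matrix2)
    ultimately show "A ** B = mat 1" "B ** A = mat 1"
      unfolding B_def by (metis adjugate_mult matrix_mul_assoc)+
  qed
  then show "A \<in> carrier GL2Z" by (auto simp: GL2Z_def invertible_def)
qed

lemma trace_square: "trace (A ** A) = (trace A)\<^sup>2 - 2 * det A" for A :: "int^2^2"
  by (simp add: matrix2 power2_eq_square algebra_simps)

lemma subgroupD:
  assumes "subgroup G GL2Z"
  shows "mat 1 \<in> G" "A \<in> G \<Longrightarrow> B \<in> G \<Longrightarrow> A ** B \<in> G"
    "A \<in> G \<Longrightarrow> det A = 1 \<or> det A = -1"
  using subgroup.one_closed[OF assms] subgroup.m_closed[OF assms] subgroup.mem_carrier[OF assms]
  by (auto simp: carrier_GL2Z)

lemma adjugate_closed: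
  assumes G: "subgroup G GL2Z" and A: "A \<in> G" "det A = 1"
  shows "adjugate A \<in> G"
proof -
  define B where "B = inv\<^bsub>GL2Z\<^esub> A"
  have "B \<in> G" using subgroup.m_inv_closed[OF G] A by (simp add: B_def)
  have "B ** A = mat 1"
    using group.l_inv[OF group_GL2Z, of A] subgroup.mem_carrier[OF G] A by (simp add: B_def)
  then have "adjugate A = (B ** A) ** adjugate A" by simp
  also have "\<dots> = B" using A by (simp add: adjugate_mult flip: matrix_mul_assoc)
  finally show ?thesis using \<open>B \<in> G\<close> by simp
qed

section \<open>Traces in a finite subgroup\<close>
locale finite_GL2Z_subgroup =
  fixes G :: "(int^2^2) set"
  assumes sub: "subgroup G GL2Z" and fin: "finite G"
begin

lemmas one_closed = subgroupD(1)[OF sub]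
  and mult_closed = subgroupD(2)[OF sub]
  and det_cases = subgroupD(3)[OF sub]
  and adj_closed = adjugate_closed[OF sub]

text \<open>Squaring sends a trace \<open>x\<close> to \<open>x\<^sup>2 \<plusminus> 2\<close>, which exceeds \<open>\<bar>x\<bar>\<close> in absolute value as soon as
\<open>\<bar>x\<bar> \<ge> 3\<close>. An element whose trace is maximal in absolute value therefore has trace at most 2.\<close>
lemma abs_trace_le_2:
  assumes "A \<in> G" shows "\<bar>trace A\<bar> \<le> 2"
proof (rule ccontr)
  assume *: "\<not> \<bar>trace A\<bar> \<le> 2"
  define m where "m = Max ((\<lambda>A. \<bar>trace A\<bar>) ` G)"
  have le: "\<bar>trace B\<bar> \<le> m" if "B \<in> G" for B
    using fin that by (auto simp: m_def)
  have "m \<in> (\<lambda>A. \<bar>trace A\<bar>) ` G" unfolding m_def using fin assms by (intro Max_in) auto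
  then obtain B where B: "B \<in> G" "m = \<bar>trace B\<bar>" by blast
  have m: "m \<ge> 3" using le[OF assms] * by linarith
  have "\<bar>(trace B)\<^sup>2 - 2 * det B\<bar> \<le> m"
    using le[OF mult_closed[OF B(1) B(1)]] by (simp add: trace_square)
  moreover have "(trace B)\<^sup>2 = m * m" by (simp add: B power2_eq_square)
  moreover have "m * m \<ge> 3 * m" using m by (intro mult_right_mono) auto
  moreover have "det B \<le> 1" using det_cases[OF B(1)] by auto
  ultimately show False using m by linarith
qed

text \<open>The square of a matrix of determinant \<open>-1\<close> and trace \<open>x\<close> has trace \<open>x\<^sup>2 + 2\<close>, which is at
most 2 only for \<open>x = 0\<close>.\<close>
lemma reflection_trace:
  assumes "A \<in> G" "det A = -1" shows "trace A = 0"
proof -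
  have "(trace A)\<^sup>2 \<le> 0"
    using abs_trace_le_2[OF mult_closed[OF assms(1) assms(1)]] assms(2)
    by (simp add: trace_square)
  then show ?thesis by simp
qed

text \<open>Write \<open>A = 1 + N\<close>. By Cayley--Hamilton \<open>N\<^sup>2 = 0\<close>, so squaring \<open>A\<close> doubles every entry of
\<open>N\<close>; in a finite group the largest such entry must vanish.\<close>
lemma unipotent_trivial:
  assumes "A \<in> G" "det A = 1" "trace A = 2" shows "A = mat 1"
proof -
  define S where "S = {A \<in> G. det A = 1 \<and> trace A = 2}"
  have finS: "finite S" using fin by (simp add: S_def)
  have sq: "B ** B \<in> S" if "B \<in> S" for B
    using that mult_closed by (auto simp: S_def trace_square det_mul)
  have ent: "(B ** B - mat 1) $ i $ j = 2 * (B - mat 1) $ i $ j" if "B \<in> S" for B i j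
  proof -
    have b: "B$2$2 = 2 - B$1$1" "B$1$1 * B$2$2 - B$1$2 * B$2$1 = 1" using that
      by (auto simp: S_def matrix2)
    have "B$1$1 * (2 - B$1$1) - B$1$2 * B$2$1 = 1" using b by simp
    then have "\<forall>i j. (B ** B - mat 1) $ i $ j = 2 * (B - mat 1) $ i $ j"
      by (simp add: matrix2 b(1) algebra_simps)
    then show ?thesis by blast
  qed
  have "(B - mat 1) $ i $ j = 0" if B: "B \<in> S" for B i j
  proof (rule ccontr)
    assume nz: "(B - mat 1) $ i $ j \<noteq> 0"
    define g where "g = (\<lambda>B::int^2^2. \<bar>(B - mat 1) $ i $ j\<bar>)"
    define m where "m = Max (g ` S)"
    have le: "g C \<le> m" if "C \<in> S" for C using finS that by (auto simp: m_def)
    have "m \<in> g ` S" unfolding m_def using finS B by (intro Max_in) auto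
    then obtain C where C: "C \<in> S" "m = g C" by blast
    have "g (C ** C) = 2 * g C" using ent[OF C(1), of i j] by (simp only: g_def abs_mult)
    then have "m \<le> 0" using le[OF sq[OF C(1)]] C by linarith
    then show False using le[OF B] nz by (simp add: g_def)
  qed
  moreover have "A \<in> S" using assms by (simp add: S_def)
  ultimately have "\<And>i j. A $ i $ j = mat 1 $ i $ j" by simp
  then show ?thesis by (simp add: vec_eq_iff)
qed

lemma trace_minus_2:
  assumes "A \<in> G" "det A = 1" "trace A = -2" shows "A = mat (-1)"
proof -
  have "A ** A = mat 1"
    using assms mult_closed by (intro unipotent_trivial) (auto simp: det_mul trace_square)
  moreover have "A ** A = mat (-1) ** A ** mat 2 - mat 1"
  proof -
    have b: "A$2$2 = -2 - A$1$1" "A$1$1 * A$2$2 - A$1$2 * A$2$1 = 1" using assms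
      by (auto simp: matrix2)
    have "A$1$1 * (-2 - A$1$1) - A$1$2 * A$2$1 = 1" using b by simp
    then show ?thesis by (simp add: matrix2 b(1) algebra_simps)
  qed
  ultimately show ?thesis by (simp add: matrix2)
qed

end

text \<open>On traceless matrices the determinant is a quadratic form of signature \<open>(1, 2)\<close>, and the
traceless parts \<open>A\<^sub>0 = A - (trace A / 2)\<close> and \<open>B\<^sub>0\<close> are timelike for it because \<open>4 det A\<^sub>0 = 4 -
(trace A)\<^sup>2 > 0\<close>. For timelike vectors the Cauchy--Schwarz inequality is reversed. Since the
adjugate of \<open>B\<close> is its inverse, the number squared on the right is \<open>2 trace (A\<^sub>0 B\<^sub>0)\<close>, that is,
up to a constant the polar form of the determinant.\<close>
lemma elliptic_reverse_Cauchy_Schwarz: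
  fixes A B :: "int^2^2"
  assumes "det A = 1" "\<bar>trace A\<bar> < 2" "det B = 1" "\<bar>trace B\<bar> < 2"
  shows "(4 - (trace A)\<^sup>2) * (4 - (trace B)\<^sup>2) \<le> (trace (A ** B) - trace (A ** adjugate B))\<^sup>2"
proof -
  define b u c where "b = A$1$2" "u = A$1$1 - A$2$2" "c = A$2$1"
  define b' u' c' where "b' = B$1$2" "u' = B$1$1 - B$2$2" "c' = B$2$1"
  define Q where "Q = - (u\<^sup>2 + 4 * b * c)"
  define Q' where "Q' = - (u'\<^sup>2 + 4 * b' * c')"
  define T where "T = u * u' + 2 * b * c' + 2 * c * b'"
  have disc: "4 - (trace C)\<^sup>2 = - ((C$1$1 - C$2$2)\<^sup>2 + 4 * C$1$2 * C$2$1)"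
    if "det C = 1" for C :: "int^2^2"
  proof -
    have "4 = 4 * det C" using that by simp
    then show ?thesis by (simp add: matrix2 power2_eq_square algebra_simps)
  qed
  have Q: "4 - (trace A)\<^sup>2 = Q" "4 - (trace B)\<^sup>2 = Q'"
    using disc[OF assms(1)] disc[OF assms(3)]
    by (simp_all add: Q_def Q'_def b_u_c_def b'_u'_c'_def)
  have T: "trace (A ** B) - trace (A ** adjugate B) = T"
    by (simp add: T_def matrix2 adjugate_def b_u_c_def b'_u'_c'_def algebra_simps)
  have sq: "x\<^sup>2 < 4" if "\<bar>x\<bar> < 2" for x :: int
    using power_strict_mono[of "\<bar>x\<bar>" 2 2] that by simp
  have pos: "Q > 0" "Q' > 0" using sq[OF assms(2)] sq[OF assms(4)] Q by linarith+
  have nz: "b \<noteq> 0" "b' \<noteq> 0" using pos zero_le_power2[of u] zero_le_power2[of u']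
    by (auto simp: Q_def Q'_def)
  define X Y where "X = b\<^sup>2 * Q'" "Y = b'\<^sup>2 * Q"
  have XY: "X > 0" "Y > 0" using pos nz by (simp_all add: X_Y_def)
  (* The combination b * B - b' * A has upper right entry 0, so its discriminant is a square.
     Expanding this square bilinearly bounds X + Y by the mixed term in T. *)
  have "0 \<le> (b * u' - b' * u)\<^sup>2" by simp
  also have "\<dots> = - X - Y - 2 * b * b' * T"
    by (simp add: X_Y_def Q_def Q'_def T_def power2_eq_square algebra_simps)
  finally have "X + Y \<le> - 2 * b * b' * T" by linarith
  then have "(X + Y)\<^sup>2 \<le> (- 2 * b * b' * T)\<^sup>2" using XY by (intro power_mono) auto
  moreover have "4 * (X * Y) \<le> (X + Y)\<^sup>2"
    using zero_le_power2[of "X - Y"] by (simp add: power2_eq_square algebra_simps)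
  ultimately have "4 * (X * Y) \<le> (- 2 * b * b' * T)\<^sup>2" by linarith
  then have "(4 * b\<^sup>2 * b'\<^sup>2) * (Q * Q') \<le> (4 * b\<^sup>2 * b'\<^sup>2) * T\<^sup>2"
    by (simp add: X_Y_def power2_eq_square algebra_simps)
  then have "Q * Q' \<le> T\<^sup>2" using nz by (subst (asm) mult_le_cancel_left_pos) auto
  then show ?thesis by (simp add: Q T)
qed


context finite_GL2Z_subgroup
begin

text \<open>This rigidity makes the rotation subgroup cyclic. The traces of \<open>A B\<close> and \<open>A B\<^sup>-\<^sup>1\<close> are
integers between -2 and 2, and the reversed Cauchy--Schwarz inequality puts them at distance at
least 3. Hence one of them is \<open>\<plusminus>2\<close>, so that \<open>A B\<close> or \<open>A B\<^sup>-\<^sup>1\<close> is \<open>\<plusminus>1\<close>.\<close>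
lemma elliptic_unique:
  assumes A: "A \<in> G" "det A = 1" "\<bar>trace A\<bar> < 2"
    and B: "B \<in> G" "det B = 1" "\<bar>trace B\<bar> < 2"
  shows "B \<in> {A, mat (-1) ** A, adjugate A, mat (-1) ** adjugate A}"
proof -
  define z z' where "z = trace (A ** B)" "z' = trace (A ** adjugate B)"
  have adjB: "adjugate B \<in> G" "det (adjugate B) = 1"
    using adj_closed B by (simp_all add: adjugate_def det_2 mult.commute)
  have z: "\<bar>z\<bar> \<le> 2" "\<bar>z'\<bar> \<le> 2"
    using abs_trace_le_2 mult_closed A B adjB by (simp_all add: z_z'_def)
  have sq: "x\<^sup>2 \<le> 1" if "\<bar>x\<bar> < 2" for x :: int
    using power_mono[of "\<bar>x\<bar>" 1 2] that by simp
  have "3 * 3 \<le> (4 - (trace A)\<^sup>2) * (4 - (trace B)\<^sup>2)"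
    using sq[OF A(3)] sq[OF B(3)] by (intro mult_mono) auto
  also have "\<dots> \<le> (z - z')\<^sup>2"
    using elliptic_reverse_Cauchy_Schwarz[OF A(2,3) B(2,3)] by (simp add: z_z'_def)
  finally have "3\<^sup>2 \<le> \<bar>z - z'\<bar>\<^sup>2" by simp
  then have "3 \<le> \<bar>z - z'\<bar>" by (subst (asm) power_mono_iff) auto
  then have "\<bar>z\<bar> = 2 \<or> \<bar>z'\<bar> = 2" using z by linarith
  moreover have central: "C \<in> {mat 1, mat (-1)}" if "C \<in> G" "det C = 1" "\<bar>trace C\<bar> = 2" for C
    using that unipotent_trivial[OF that(1,2)] trace_minus_2[OF that(1,2)] by (auto simp: abs_if split: if_splits)
  moreover have "A ** B \<in> G" "A ** adjugate B \<in> G" "det (A ** B) = 1" "det (A ** adjugate B) = 1"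
    using A B adjB mult_closed by (simp_all add: det_mul)
  ultimately have "A ** B \<in> {mat 1, mat (-1)} \<or> A ** adjugate B \<in> {mat 1, mat (-1)}"
    unfolding z_z'_def by blast
  moreover have "B = adjugate A ** (A ** B)" "adjugate B = adjugate A ** (A ** adjugate B)"
    using A by (simp_all add: matrix_mul_assoc adjugate_mult)
  moreover have "adjugate (adjugate C) = C" "adjugate (C ** mat (-1)) = mat (-1) ** adjugate C"
    "C ** mat (-1) = mat (-1) ** C" for C
    by (simp_all add: adjugate_def matrix2)
  ultimately show ?thesis
    by (elim disjE insertE emptyE) (metis insertCI matrix_mul_rid)+
qed

end

section \<open>The rotation subgroup is cyclic\<close>

text \<open>If \<open>det r = 1\<close>, every power of \<open>r\<close> is an integral combination of 1 and \<open>r\<close>, and the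
coefficients depend only on the trace \<open>t\<close> of \<open>r\<close>: computations take place in \<open>\<int>[X] / (X\<^sup>2 - t X +
1)\<close>. Working with coefficient pairs instead of exponents makes two groups with the same \<open>t\<close>
directly comparable.\<close>
fun combination :: "int^2^2 \<Rightarrow> int \<times> int \<Rightarrow> int^2^2" where
  "combination r (a, b) = mat a + mat b ** r"

fun coeff_mult :: "int \<Rightarrow> int \<times> int \<Rightarrow> int \<times> int \<Rightarrow> int \<times> int" where
  "coeff_mult t (a, b) (c, d) = (a * c - b * d, a * d + b * c + t * b * d)"

lemma Cayley_Hamilton_2:
  "r ** r = mat (trace r) ** r - mat (det r)" for r :: "int^2^2"
  by (simp add: matrix2 algebra_simps)

lemma combination_mult:
  assumes "det r = 1"
  shows "combination r p ** combination r q = combination r (coeff_mult (trace r) p q)"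
proof (cases p; cases q)
  fix a b c d assume pq: "p = (a, b)" "q = (c, d)"
  have "combination r p ** combination r q = mat (a * c) + mat (a * d + b * c) ** r + mat (b * d) ** (r ** r)"
    by (simp add: pq matrix2 algebra_simps)
  also have "r ** r = mat (trace r) ** r - mat 1" using assms Cayley_Hamilton_2[of r] by simp
  also have "mat (a * c) + mat (a * d + b * c) ** r + mat (b * d) ** (mat (trace r) ** r - mat 1) =
    combination r (coeff_mult (trace r) p q)"
    by (simp add: pq matrix2 algebra_simps)
  finally show "combination r p ** combination r q = combination r (coeff_mult (trace r) p q)" .
qed

text \<open>The coefficient pairs of the powers of \<open>r\<close>, when \<open>r\<close> has finite order and trace \<open>t\<close>. The
orders are 4, 6, 3, 2, 1 for \<open>t = 0, 1, -1, -2, 2\<close>.\<close>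
definition rotation_coeffs :: "int \<Rightarrow> (int \<times> int) set" where
  "rotation_coeffs t =
    (if t = 0 then {(1,0), (-1,0), (0,1), (0,-1)}
     else if t = 1 then {(1,0), (-1,0), (0,1), (0,-1), (1,-1), (-1,1)}
     else if t = -1 then {(1,0), (0,1), (-1,-1)}
     else if t = -2 then {(1,0), (-1,0)}
     else {(1,0)})"

text \<open>The trace of a generator of the rotation subgroup, read off from the set of traces that
occur. A cyclic group of order 6 also contains traces \<open>-1\<close> and \<open>-2\<close>, and one of order 4 contains
\<open>-2\<close>, whence the order of the tests.\<close>
definition rotation_trace :: "(int^2^2) set \<Rightarrow> int" where
  "rotation_trace G =
    (let T = trace ` {A \<in> G. det A = 1}
     in if 0 \<in> T then 0 else if 1 \<in> T then 1 else if -1 \<in> T then -1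
        else if -2 \<in> T then -2 else 2)"

context finite_GL2Z_subgroup
begin

text \<open>An elliptic rotation \<open>r\<close> (absolute value of the trace below 2) determines all others up to
sign and inversion, so the rotations are among \<open>\<plusminus>1\<close>, \<open>\<plusminus>r\<close>, \<open>\<plusminus>r\<^sup>-\<^sup>1\<close>. Whether the signs occur is
decided by \<open>r\<close>: for trace 0 or 1 a power of \<open>r\<close> is \<open>-1\<close>; if the trace is \<open>-1\<close> and no rotation has
trace 1, then \<open>-1\<close> cannot be present, because \<open>-r\<close> would have trace 1. Without elliptic elements
only \<open>\<plusminus>1\<close> remain.\<close>
lemma rotation_subgroup:
  obtains r where "r \<in> G" "det r = 1" "trace r = rotation_trace G"
    "{A \<in> G. det A = 1} = combination r ` rotation_coeffs (rotation_trace G)"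
    "inj_on (combination r) (rotation_coeffs (rotation_trace G))"
proof -
  define T where "T = trace ` {A \<in> G. det A = 1}"
  define t where "t = rotation_trace G"
  have t: "t = (if 0 \<in> T then 0 else if 1 \<in> T then 1 else if -1 \<in> T then -1 else if -2 \<in> T then -2 else 2)"
    by (simp add: t_def rotation_trace_def T_def)
  have "2 \<in> T" using one_closed by (auto simp: T_def matrix2 intro!: image_eqI[of _ _ "mat 1"])
  then have tT: "t \<in> T" by (simp add: t)
  then obtain r where r: "r \<in> G" "det r = 1" "trace r = t" by (auto simp: T_def)
  have T: "A \<in> G \<Longrightarrow> det A = 1 \<Longrightarrow> trace A \<in> T" for A by (auto simp: T_def)
  have ts: "t \<in> {-2,-1,0,1,2}" by (simp add: t)
  have small: "trace A \<in> {-2,-1,0,1,2}" if "A \<in> G" for A using abs_trace_le_2[OF that] by auto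
  have neg_trace: "trace (mat (-1) ** A) = - trace A" "trace (adjugate A) = trace A"
    "det (mat (-1) ** A) = det A" for A :: "int^2^2"
    by (simp_all add: matrix2 adjugate_def)
  have adj: "adjugate r = combination r (t, -1)" using r by (simp add: matrix2 adjugate_def)
  have comb: "combination r (1,0) = mat 1" "combination r (-1,0) = mat (-1)" "combination r (0,1) = r"
     "combination r (0,-1) = mat (-1) ** r"
     "combination r (-t,1) = mat (-1) ** adjugate r"
     using r by (simp_all add: matrix2 adjugate_def)
  have r2: "r$2$2 = t - r$1$1" "r$1$2 * r$2$1 = r$1$1 * (t - r$1$1) - 1" using r by (auto simp: matrix2)
  (* If an integral matrix of determinant 1 is triangular, its diagonal entries are both 1 or
     both -1, so it is not elliptic. *)
  have nonscalar: "r$1$2 \<noteq> 0" if "\<bar>t\<bar> < 2"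
  proof
    assume "r$1$2 = 0"
    then have "r$1$1 * (t - r$1$1) = 1" using r2 by simp
    then have "t = 2 \<or> t = -2" by (auto simp: zmult_eq_1_iff)
    then show False using that by auto
  qed
  have inj: "inj_on (combination r) (rotation_coeffs t)"
  proof (cases "\<bar>t\<bar> < 2")
    case True
    have "p = q" if "combination r p = combination r q" for p q
      using that nonscalar[OF True] by (cases p; cases q) (auto simp: matrix2)
    then show ?thesis by (auto intro: inj_onI)
  next
    case False
    then show ?thesis using ts by (auto simp: rotation_coeffs_def matrix2)
  qed
  have central: "A \<in> {mat 1, mat (-1)}" if "A \<in> G" "det A = 1" "\<not> \<bar>trace A\<bar> < 2" for A
    using that unipotent_trivial[OF that(1,2)] trace_minus_2[OF that(1,2)] small[OF that(1)] by auto
  have "{A \<in> G. det A = 1} = combination r ` rotation_coeffs t"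
  proof (cases "\<bar>t\<bar> < 2")
    case True
    have adj_r: "adjugate r \<in> G" "det (adjugate r) = 1"
      using adj_closed r by (simp_all add: adjugate_def det_2 mult.commute)
    have pow: "t = 0 \<Longrightarrow> r ** r = mat (-1)" "t = 1 \<Longrightarrow> r ** r ** r = mat (-1)"
    proof -
      have step: "r ** combination r (a, b) = combination r (- b, a + t * b)" for a b
        using combination_mult[OF r(2), of "(0,1)" "(a,b)"] r(3) comb by simp
      show "t = 0 \<Longrightarrow> r ** r = mat (-1)"
        using step[of 0 1] comb by (simp del: combination.simps)
      show "t = 1 \<Longrightarrow> r ** r ** r = mat (-1)"
        using step[of 0 1] step[of "-1" 1] comb r(2) adjugate_mult(2)[of r]
        by (simp del: combination.simps flip: matrix_mul_assoc)
    qed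
    have neg: "mat (-1) \<in> G" if "t \<noteq> -1"
      using that True ts pow mult_closed[OF r(1) r(1)]
        mult_closed[OF mult_closed[OF r(1) r(1)] r(1)] by auto
    have no_neg: "mat (-1) \<notin> G" if "t = -1"
      using T[OF mult_closed[OF _ r(1)], of "mat (-1)"] r neg_trace[of r] that t by (auto split: if_splits)
    have neg_adj: "t = 0 \<Longrightarrow> mat (-1) ** adjugate r = r" "t = 0 \<Longrightarrow> adjugate r = mat (-1) ** r"
      using r by (auto simp: matrix2 adjugate_def)
    show ?thesis
    proof (rule Set.set_eqI)
      fix A
      have image: "A \<in> combination r ` rotation_coeffs t \<longleftrightarrow>
        (if t = -1 then A \<in> {mat 1, r, adjugate r}
         else A \<in> {mat 1, mat (-1), r, mat (-1) ** r, adjugate r, mat (-1) ** adjugate r})"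
        using comb adj neg_adj True ts by (auto simp: rotation_coeffs_def simp del: combination.simps)
      have "A \<in> G \<and> det A = 1 \<longleftrightarrow>
        (if t = -1 then A \<in> {mat 1, r, adjugate r}
         else A \<in> {mat 1, mat (-1), r, mat (-1) ** r, adjugate r, mat (-1) ** adjugate r})"
      proof
        assume A: "A \<in> G \<and> det A = 1"
        show "if t = -1 then A \<in> {mat 1, r, adjugate r}
         else A \<in> {mat 1, mat (-1), r, mat (-1) ** r, adjugate r, mat (-1) ** adjugate r}"
        proof (cases "\<bar>trace A\<bar> < 2")
          case True
          have "A \<in> {r, mat (-1) ** r, adjugate r, mat (-1) ** adjugate r}"
            using elliptic_unique[of r A] r A True \<open>\<bar>t\<bar> < 2\<close> by auto
          moreover have "t = -1 \<Longrightarrow> trace A \<noteq> 1" using T[of A] A t by (auto split: if_splits)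
          ultimately show ?thesis using neg_trace[of r] neg_trace[of "adjugate r"] r by auto
        next
          case False
          then have "A \<in> {mat 1, mat (-1)}" using central A by blast
          then show ?thesis using no_neg A by auto
        qed
      next
        assume "if t = -1 then A \<in> {mat 1, r, adjugate r}
         else A \<in> {mat 1, mat (-1), r, mat (-1) ** r, adjugate r, mat (-1) ** adjugate r}"
        then show "A \<in> G \<and> det A = 1"
          using one_closed r adj_r neg mult_closed neg_trace(3)[of r] neg_trace(3)[of "adjugate r"]
            neg_trace(3)[of "mat 1"] by (auto split: if_splits)
      qed
      then show "A \<in> {A \<in> G. det A = 1} \<longleftrightarrow> A \<in> combination r ` rotation_coeffs t"
        using image by simp
    qed
  next
    case False
    then have t2: "t = 2 \<or> t = -2" using ts by auto
    have "A \<in> {mat 1, mat (-1)}" if "A \<in> G" "det A = 1" for A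
      using central[OF that] small[OF that(1)] T[OF that] t2 t by (auto split: if_splits)
    moreover have "t = 2 \<Longrightarrow> mat (-1) \<notin> G"
      using T[of "mat (-1)"] t by (auto simp: matrix2 split: if_splits)
    moreover have "t = -2 \<Longrightarrow> mat (-1) \<in> G" using trace_minus_2[OF r(1,2)] r by simp
    moreover have "det (mat (-1) :: int^2^2) = 1" by (simp add: matrix2)
    ultimately show ?thesis using t2 one_closed comb
      by (auto simp: rotation_coeffs_def simp del: combination.simps)
  qed
  then show ?thesis using that r inj by (simp add: t_def)
qed

end


section \<open>Finite subgroups are cyclic or dihedral\<close>
definition has_reflection :: "(int^2^2) set \<Rightarrow> bool" where
  "has_reflection G \<longleftrightarrow> (\<exists>s\<in>G. det s = -1)"

text \<open>A pair \<open>(p, e)\<close> stands for the product of the rotation with coefficients \<open>p\<close> and, if \<open>e\<close>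
holds, a fixed reflection \<open>s\<close> on its right.\<close>
definition dihedral_words :: "int \<Rightarrow> bool \<Rightarrow> ((int \<times> int) \<times> bool) set" where
  "dihedral_words t b = rotation_coeffs t \<times> (if b then UNIV else {False})"

text \<open>Moving \<open>s\<close> across \<open>c + d r\<close> replaces \<open>r\<close> by \<open>r\<^sup>-\<^sup>1 = t - r\<close>, which turns the coefficients
\<open>(c, d)\<close> into \<open>(c + t d, - d)\<close>.\<close>
fun dihedral_mult :: "int \<Rightarrow> (int \<times> int) \<times> bool \<Rightarrow> (int \<times> int) \<times> bool \<Rightarrow> (int \<times> int) \<times> bool" where
  "dihedral_mult t (p, e) ((c, d), e') =
    (coeff_mult t p (if e then (c + t * d, - d) else (c, d)), e \<noteq> e')"

lemma dihedral_mult_closed: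
  assumes "x \<in> dihedral_words t b" "y \<in> dihedral_words t b"
  shows "dihedral_mult t x y \<in> dihedral_words t b"
proof -
  have mult: "coeff_mult t p q \<in> rotation_coeffs t"
    if "p \<in> rotation_coeffs t" "q \<in> rotation_coeffs t" for p q
    using that by (auto simp: rotation_coeffs_def split: if_splits)
  have conj: "(c + t * d, - d) \<in> rotation_coeffs t" if "(c, d) \<in> rotation_coeffs t" for c d
    using that by (auto simp: rotation_coeffs_def split: if_splits)
  obtain p e c d e' where xy: "x = (p, e)" "y = ((c, d), e')" by (metis surj_pair)
  show ?thesis
    using assms mult conj by (auto simp: dihedral_words_def xy split: if_splits)
qed

context finite_GL2Z_subgroup
begin

lemma reflection_square:
  assumes "s \<in> G" "det s = -1" shows "s ** s = mat 1"
proof -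
  have "s ** s = mat 0 ** s - mat (-1)"
    using Cayley_Hamilton_2[of s] reflection_trace[OF assms] assms by simp
  also have "\<dots> = mat 1" by (simp add: matrix2)
  finally show ?thesis .
qed

text \<open>The product \<open>s r\<close> has determinant \<open>-1\<close> as well, so that \<open>s r s r = 1\<close>.\<close>
lemma reflection_inverts:
  assumes s: "s \<in> G" "det s = -1" and r: "r \<in> G" "det r = 1"
  shows "s ** r = adjugate r ** s"
proof -
  have "(s ** r) ** (s ** r) = mat 1"
    using mult_closed s r by (intro reflection_square) (auto simp: det_mul)
  then have "adjugate r ** s = (s ** r ** (s ** r)) ** (adjugate r ** s)" by simp
  also have "\<dots> = s ** r ** s ** (r ** adjugate r) ** s" by (simp add: matrix_mul_assoc)
  also have "\<dots> = s ** r ** (s ** s)" using r by (simp add: adjugate_mult matrix_mul_assoc)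
  also have "\<dots> = s ** r" by (simp add: reflection_square s)
  finally show ?thesis by simp
qed

text \<open>The multiplication on words depends only on the two invariants of the group, which is what
makes these invariants determine the isomorphism type.\<close>
lemma dihedral_parametrization:
  defines "t \<equiv> rotation_trace G"
  defines "X \<equiv> dihedral_words t (has_reflection G)"
  obtains h where "bij_betw h X G"
    "\<And>x y. x \<in> X \<Longrightarrow> y \<in> X \<Longrightarrow> h (dihedral_mult t x y) = h x ** h y"
proof -
  obtain r where "r \<in> G" and r: "det r = 1" "trace r = t"
    and rot: "{A \<in> G. det A = 1} = combination r ` rotation_coeffs t"
    and inj: "inj_on (combination r) (rotation_coeffs t)"
    using rotation_subgroup unfolding t_def by blast
  obtain s where s: "has_reflection G \<Longrightarrow> s \<in> G \<and> det s = -1"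
    by (auto simp: has_reflection_def)
  define h where "h = (\<lambda>(p, e). if e then combination r p ** s else combination r p)"
  have combG: "combination r p \<in> G" "det (combination r p) = 1" if "p \<in> rotation_coeffs t" for p
    using rot that by auto
  have coset: "A ** s \<in> combination r ` rotation_coeffs t" "A ** s ** s = A"
    if "A \<in> G" "det A \<noteq> 1" for A
  proof -
    have "det A = -1" using det_cases that by blast
    then have s': "s \<in> G" "det s = -1" using s that by (auto simp: has_reflection_def)
    show "A ** s ** s = A" using reflection_square[OF s'] by (simp flip: matrix_mul_assoc)
    show "A ** s \<in> combination r ` rotation_coeffs t"
      using rot mult_closed that s' \<open>det A = -1\<close> by (auto simp: det_mul)
  qed
  have conj: "s ** combination r (c, d) = combination r (c + t * d, - d) ** s"
    if refl: "has_reflection G" for c d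
  proof -
    have s': "s \<in> G" "det s = -1" using s that by auto
    have "s ** r = adjugate r ** s" using reflection_inverts[OF s' \<open>r \<in> G\<close>] r by blast
    moreover have "s ** combination r (c, d) = mat c ** s + mat d ** (s ** r)"
      by (simp add: matrix2 algebra_simps)
    moreover have "combination r (c + t * d, - d) ** s = mat c ** s + mat d ** (adjugate r ** s)"
      using r(2) by (auto simp: matrix2 adjugate_def algebra_simps)
    ultimately show ?thesis by simp
  qed
  have "bij_betw h X G"
  proof (rule bij_betwI')
    fix x y assume xy: "x \<in> X" "y \<in> X"
    obtain p e q f where pq: "x = (p, e)" "y = (q, f)" by (metis surj_pair)
    have pqC: "p \<in> rotation_coeffs t" "q \<in> rotation_coeffs t" using xy by (auto simp: X_def dihedral_words_def pq)
    have e: "e \<or> f \<Longrightarrow> has_reflection G" using xy by (auto simp: X_def dihedral_words_def pq split: if_splits)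
    have "p = q \<and> e = f" if eq: "h x = h y"
    proof -
      have "det (h x) = (if e then -1 else 1)" "det (h y) = (if f then -1 else 1)"
        using combG pqC s e by (auto simp: h_def pq det_mul)
      then have "e = f" using eq by (auto split: if_splits)
      moreover have "combination r p = combination r q"
      proof (cases e)
        case True
        then have "combination r p ** s ** s = combination r q ** s ** s"
          using eq \<open>e = f\<close> by (simp add: h_def pq)
        then show ?thesis using reflection_square s e True
          by (simp flip: matrix_mul_assoc)
      qed (use eq \<open>e = f\<close> in \<open>simp add: h_def pq\<close>)
      ultimately show ?thesis using inj pqC by (auto dest: inj_onD)
    qed
    then show "h x = h y \<longleftrightarrow> x = y" using pq by auto
  next
    fix x assume "x \<in> X"
    then show "h x \<in> G"
      using combG s mult_closed by (auto simp: h_def X_def dihedral_words_def split: if_splits)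
  next
    fix A assume A: "A \<in> G"
    show "\<exists>x\<in>X. A = h x"
    proof (cases "det A = 1")
      case True
      then obtain p where "p \<in> rotation_coeffs t" "A = combination r p" using rot A by blast
      then show ?thesis by (intro bexI[of _ "(p, False)"]) (auto simp: h_def X_def dihedral_words_def)
    next
      case False
      then obtain p where p: "p \<in> rotation_coeffs t" "A ** s = combination r p" using coset A by blast
      moreover have "has_reflection G" using A False det_cases by (auto simp: has_reflection_def)
      ultimately show ?thesis using coset(2)[OF A False]
        by (intro bexI[of _ "(p, True)"]) (auto simp: h_def X_def dihedral_words_def)
    qed
  qed
  moreover have "h (dihedral_mult t x y) = h x ** h y" if xy: "x \<in> X" "y \<in> X" for x y
  proof -
    obtain p e c d f where pq: "x = (p, e)" "y = ((c, d), f)" by (metis surj_pair)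
    have e: "e \<or> f \<Longrightarrow> has_reflection G" using xy by (auto simp: X_def dihedral_words_def pq split: if_splits)
    have mult: "combination r p ** combination r q = combination r (coeff_mult t p q)" for p q
      using combination_mult[OF r(1)] r(2) by simp
    have move: "combination r p ** s ** combination r (c, d) = combination r (coeff_mult t p (c + t * d, - d)) ** s"
      if e
      using conj[of c d] e that mult by (metis matrix_mul_assoc)
    show ?thesis
    proof (cases e)
      case False
      then show ?thesis by (simp add: h_def pq mult matrix_mul_assoc del: combination.simps coeff_mult.simps)
    next
      case True
      have "s ** s = mat 1" using reflection_square s e True by blast
      then show ?thesis using True move
        by (simp add: h_def pq matrix_mul_assoc del: combination.simps coeff_mult.simps)
          (simp flip: matrix_mul_assoc del: combination.simps coeff_mult.simps)
    qed
  qed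
  ultimately show ?thesis using that by blast
qed

end

text \<open>Both groups carry the multiplication of the same set of words; the isomorphism matches equal
words.\<close>
lemma isomorphic_of_same_type:
  assumes "finite_GL2Z_subgroup G" "finite_GL2Z_subgroup H"
    and t: "rotation_trace G = rotation_trace H" and refl: "has_reflection G = has_reflection H"
  shows "GL2Z\<lparr>carrier := G\<rparr> \<cong> GL2Z\<lparr>carrier := H\<rparr>"
proof -
  define t where "t = rotation_trace G"
  define X where "X = dihedral_words t (has_reflection G)"
  obtain h where h: "bij_betw h X G"
    "\<And>x y. x \<in> X \<Longrightarrow> y \<in> X \<Longrightarrow> h (dihedral_mult t x y) = h x ** h y"
    using finite_GL2Z_subgroup.dihedral_parametrization[OF assms(1)] unfolding X_def t_def by blast
  obtain k where k: "bij_betw k X H"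
    "\<And>x y. x \<in> X \<Longrightarrow> y \<in> X \<Longrightarrow> k (dihedral_mult t x y) = k x ** k y"
    using finite_GL2Z_subgroup.dihedral_parametrization[OF assms(2)]
    unfolding X_def t_def t refl by blast
  define f where "f = k \<circ> inv_into X h"
  have f: "f (h x) = k x" if "x \<in> X" for x
    using h(1) that by (simp add: f_def bij_betw_def)
  have "bij_betw f G H" unfolding f_def
    using bij_betw_trans[OF bij_betw_inv_into[OF h(1)] k(1)] .
  moreover have "f (A ** B) = f A ** f B" if AB: "A \<in> G" "B \<in> G" for A B
  proof -
    obtain x y where xy: "x \<in> X" "y \<in> X" "A = h x" "B = h y"
      using AB h(1) by (auto simp: bij_betw_def)
    have "dihedral_mult t x y \<in> X" using dihedral_mult_closed xy by (simp add: X_def)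
    then show ?thesis using xy h(2) k(2) f by metis
  qed
  ultimately have "f \<in> iso (GL2Z\<lparr>carrier := G\<rparr>) (GL2Z\<lparr>carrier := H\<rparr>)"
    by (auto simp: iso_def hom_def bij_betw_def)
  then show ?thesis by (auto simp: is_iso_def)
qed


section \<open>Polygons with integral vertices\<close>

text \<open>Vertices are kept as pairs of integers, so that questions about symmetries become integer
arithmetic.\<close>
definition lattice_vector :: "int \<times> int \<Rightarrow> real^2" where
  "lattice_vector v = vector [of_int (fst v), of_int (snd v)]"

definition lattice_act :: "int^2^2 \<Rightarrow> int \<times> int \<Rightarrow> int \<times> int" where
  "lattice_act A v = (A$1$1 * fst v + A$1$2 * snd v, A$2$1 * fst v + A$2$2 * snd v)"

lemma lattice_vector_nth [simp]:
  "lattice_vector v $ 1 = of_int (fst v)" "lattice_vector v $ 2 = of_int (snd v)"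
  by (simp_all add: lattice_vector_def)

lemma inj_lattice_vector: "inj lattice_vector"
  by (rule injI) (auto simp: vec_eq_iff forall_2 prod_eq_iff)

lemma GL2Z_act_lattice_vector: "GL2Z_act A (lattice_vector v) = lattice_vector (lattice_act A v)"
  by (simp add: GL2Z_act_def lattice_act_def vec_eq_iff forall_2 matrix_vector_mult_def sum_2 map_matrix_def)

lemma inner_2: "x \<bullet> y = x$1 * y$1 + x$2 * y$2" for x y :: "real^2"
  by (simp add: inner_vec_def sum_2)

definition lattice_polygon :: "(int \<times> int) set \<Rightarrow> (real^2) set" where
  "lattice_polygon V = convex hull (lattice_vector ` V)"

text \<open>All points lie on one level curve of the positive definite form \<open>p x\<^sup>2 + 2 q x y + r y\<^sup>2\<close>.\<close>
definition on_ellipse :: "(int \<times> int) set \<Rightarrow> bool" where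
  "on_ellipse V \<longleftrightarrow> (\<exists>p q r c. p > 0 \<and> p * r > q\<^sup>2 \<and>
    (\<forall>(x, y)\<in>V. p * x\<^sup>2 + 2 * q * x * y + r * y\<^sup>2 = c))"

text \<open>Ellipses are strictly convex. With \<open>\<langle>v, w\<rangle>\<close> the bilinear form of the ellipse \<open>\<langle>v, v\<rangle> = c\<close>,
expanding \<open>\<langle>v - w, v - w\<rangle> > 0\<close> gives \<open>\<langle>v, w\<rangle> < c\<close> for any other point \<open>w\<close> of the set, so the
functional \<open>\<langle>v, \<cdot>\<rangle>\<close> separates \<open>v\<close> from the convex hull of the other points.\<close>
lemma extreme_points_of_lattice_polygon:
  assumes "finite V" "on_ellipse V"
  shows "x extreme_point_of lattice_polygon V \<longleftrightarrow> x \<in> lattice_vector ` V"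
  unfolding lattice_polygon_def
proof (rule extreme_point_of_convex_hull_convex_independent)
  show "compact (lattice_vector ` V)" using assms by (simp add: finite_imp_compact)
next
  fix a assume "a \<in> lattice_vector ` V"
  then obtain v where v: "v \<in> V" "a = lattice_vector v" by blast
  obtain p q r c where pos: "p > 0" "p * r > q\<^sup>2"
    and "\<forall>(x, y)\<in>V. p * x\<^sup>2 + 2 * q * x * y + r * y\<^sup>2 = c"
    using assms(2) unfolding on_ellipse_def by (elim exE conjE)
  then have ell: "p * x\<^sup>2 + 2 * q * x * y + r * y\<^sup>2 = c" if "(x, y) \<in> V" for x y
    using that by blast
  obtain x y where xy: "v = (x, y)" by (cases v)
  define l :: "real^2" where "l = lattice_vector (p * x + q * y, q * x + r * y)"
  have l: "l \<bullet> lattice_vector (x', y') = of_int (p * x * x' + q * (x * y' + y * x') + r * y * y')" for x' y'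
    by (simp add: l_def inner_2 algebra_simps)
  have "convex hull (lattice_vector ` V - {a}) \<subseteq> {w. l \<bullet> w < of_int c}"
  proof (rule hull_minimal)
    show "lattice_vector ` V - {a} \<subseteq> {w. l \<bullet> w < of_int c}"
    proof clarify
      fix x' y' assume w: "(x', y') \<in> V" "lattice_vector (x', y') \<noteq> a"
      then have ne: "(x', y') \<noteq> (x, y)" using v xy by auto
      define d e where "d = x' - x" "e = y' - y"
      have "p * (p * d\<^sup>2 + 2 * q * d * e + r * e\<^sup>2) = (p * d + q * e)\<^sup>2 + (p * r - q\<^sup>2) * e\<^sup>2"
        by (simp add: power2_eq_square algebra_simps)
      also have "\<dots> > 0"
      proof (cases "e = 0")
        case True
        then have "d \<noteq> 0" using ne by (auto simp: d_e_def)
        then show ?thesis using pos True by simp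
      next
        case False
        then have "(p * r - q\<^sup>2) * e\<^sup>2 > 0" using pos by simp
        then show ?thesis using zero_le_power2[of "p * d + q * e"] by linarith
      qed
      finally have "p * d\<^sup>2 + 2 * q * d * e + r * e\<^sup>2 > 0" using pos by (simp add: zero_less_mult_iff)
      moreover have "p * d\<^sup>2 + 2 * q * d * e + r * e\<^sup>2 =
        (p * x\<^sup>2 + 2 * q * x * y + r * y\<^sup>2) + (p * x'\<^sup>2 + 2 * q * x' * y' + r * y'\<^sup>2)
        - 2 * (p * x * x' + q * (x * y' + y * x') + r * y * y')"
        by (simp add: d_e_def power2_eq_square algebra_simps)
      ultimately have "p * x * x' + q * (x * y' + y * x') + r * y * y' < c"
        using ell[OF w(1)] ell[of x y] v xy by auto
      then show "l \<bullet> lattice_vector (x', y') < of_int c" unfolding l of_int_less_iff .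
    qed
  qed (rule convex_halfspace_lt)
  moreover have "l \<bullet> a = of_int c"
    unfolding v(2) xy l of_int_eq_iff using ell[of x y] v xy
    by (simp add: power2_eq_square algebra_simps)
  ultimately show "a \<notin> convex hull (lattice_vector ` V - {a})" by auto
qed

definition lattice_symmetries :: "(int \<times> int) set \<Rightarrow> (int^2^2) set" where
  "lattice_symmetries V = {A \<in> carrier GL2Z. lattice_act A ` V = V}"

text \<open>A linear automorphism of a polygon permutes its extreme points, and these are exactly the
points of \<open>V\<close>.\<close>
lemma Aut_lattice_polygon:
  assumes "finite V" "on_ellipse V"
  shows "Aut_polygon (lattice_polygon V) = lattice_symmetries V"
proof -
  have "GL2Z_act A ` lattice_polygon V = lattice_polygon V \<longleftrightarrow> lattice_act A ` V = V" for A
  proof -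
    define W where "W = lattice_act A ` V"
    have "linear (GL2Z_act A)" unfolding GL2Z_act_def by (rule matrix_vector_mul_linear)
    then have image: "GL2Z_act A ` lattice_polygon V = lattice_polygon W"
      by (simp add: lattice_polygon_def convex_hull_linear_image image_image GL2Z_act_lattice_vector W_def)
    have "W = V" if eq: "lattice_polygon W = lattice_polygon V"
    proof -
      have "lattice_vector ` V \<subseteq> lattice_vector ` W"
      proof
        fix x assume "x \<in> lattice_vector ` V"
        then have "x extreme_point_of lattice_polygon W"
          using extreme_points_of_lattice_polygon[OF assms] eq by simp
        then show "x \<in> lattice_vector ` W"
          unfolding lattice_polygon_def by (rule extreme_point_of_convex_hull)
      qed
      then have "V \<subseteq> W" by (simp add: inj_image_subset_iff[OF inj_lattice_vector])
      moreover have "card W \<le> card V" "finite W" using assms by (simp_all add: W_def card_image_le)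
      ultimately show "W = V" using card_seteq by metis
    qed
    then show ?thesis using image by (auto simp: W_def)
  qed
  then show ?thesis by (simp add: Aut_polygon_def lattice_symmetries_def)
qed

text \<open>The origin is interior because the points balance out: a functional that is nonnegative on
\<open>V\<close> vanishes on all of \<open>V\<close>, as its values there sum to 0, and hence is zero because \<open>V\<close> contains
two independent points. So no supporting line passes through the origin.\<close>
lemma Fano_lattice_polygon:
  assumes "finite V" and prim: "\<And>x y. (x, y) \<in> V \<Longrightarrow> coprime x y"
    and sum: "(\<Sum>v\<in>V. v) = 0"
    and vw: "(a, b) \<in> V" "(c, d) \<in> V" "a * d \<noteq> b * c"
  shows "Fano_polygon (lattice_polygon V)"
proof -
  define P where "P = lattice_polygon V"
  have conv: "convex P" and V_P: "lattice_vector ` V \<subseteq> P"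
    by (simp_all add: P_def lattice_polygon_def hull_subset)
  have lsum: "(\<Sum>v\<in>V. lattice_vector v) = 0"
  proof -
    have "(\<Sum>v\<in>V. fst v) = 0" "(\<Sum>v\<in>V. snd v) = 0"
      using sum by (simp_all add: prod_eq_iff fst_sum snd_sum)
    then show ?thesis
      by (simp add: vec_eq_iff forall_2 flip: of_int_sum)
  qed
  have orth: "l = 0" if "l \<bullet> lattice_vector (a, b) = 0" "l \<bullet> lattice_vector (c, d) = 0" for l :: "real^2"
  proof -
    have eqs: "l$1 * of_int a + l$2 * of_int b = 0" "l$1 * of_int c + l$2 * of_int d = 0"
      using that by (simp_all add: inner_2)
    have "l$1 * of_int (a * d - b * c) =
        of_int d * (l$1 * of_int a + l$2 * of_int b) - of_int b * (l$1 * of_int c + l$2 * of_int d)"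
      "l$2 * of_int (a * d - b * c) =
        of_int a * (l$1 * of_int c + l$2 * of_int d) - of_int c * (l$1 * of_int a + l$2 * of_int b)"
      by (simp_all add: algebra_simps)
    then have "l$1 * of_int (a * d - b * c) = 0" "l$2 * of_int (a * d - b * c) = 0"
      unfolding eqs by simp_all
    moreover have "(of_int (a * d - b * c) :: real) \<noteq> 0" using vw(3) by (simp only: of_int_eq_0_iff)
    ultimately show "l = 0" by (simp add: vec_eq_iff forall_2)
  qed
  have "0 \<in> P"
  proof -
    have "V \<noteq> {}" using vw by auto
    have "(\<Sum>v\<in>V. (1 / card V) *\<^sub>R lattice_vector v) \<in> P"
      using assms(1) \<open>V \<noteq> {}\<close> conv V_P by (intro convex_sum) (auto simp: card_gt_0_iff)
    then show ?thesis using lsum by (simp flip: scaleR_sum_right)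
  qed
  have P_zero: "l \<bullet> y = 0"
    if l: "\<And>v. v \<in> V \<Longrightarrow> 0 \<le> l \<bullet> lattice_vector v" for l y :: "real^2"
  proof -
    have "(\<Sum>v\<in>V. l \<bullet> lattice_vector v) = 0"
      using lsum by (simp flip: inner_sum_right)
    then have "\<forall>v\<in>V. l \<bullet> lattice_vector v = 0"
      using l assms(1) by (subst (asm) sum_nonneg_eq_0_iff) auto
    then show ?thesis using orth vw by fastforce
  qed
  have "affine hull P = UNIV"
  proof (rule ccontr)
    assume "affine hull P \<noteq> UNIV"
    moreover have "affine hull P = span P" using \<open>0 \<in> P\<close> by (simp add: affine_hull_span_0 hull_inc)
    ultimately have "span P \<noteq> UNIV" by simp
    then obtain l where l: "l \<noteq> 0" "\<And>x. x \<in> span P \<Longrightarrow> l \<bullet> x = 0"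
      using span_not_UNIV_orthogonal[of P] by blast
    moreover have "lattice_vector v \<in> span P" if "v \<in> V" for v
      using V_P that by (intro span_base) blast
    ultimately have "l = 0" using vw by (intro orth) blast+
    then show False using l by simp
  qed
  then have interior: "interior P = rel_interior P" by (simp add: rel_interior_interior)
  have "0 \<in> interior P"
  proof (rule ccontr)
    assume "0 \<notin> interior P"
    then have *: "0 \<notin> rel_interior P" using interior by simp
    have "0 \<in> closure P" using \<open>0 \<in> P\<close> closure_subset by blast
    then obtain l where l: "l \<noteq> 0" "\<And>y. y \<in> closure P \<Longrightarrow> l \<bullet> 0 \<le> l \<bullet> y"
      by (rule supporting_hyperplane_relative_frontier[OF conv _ *]) blast
    have "0 \<le> l \<bullet> lattice_vector v" if "v \<in> V" for v
    proof -
      have "lattice_vector v \<in> closure P" using V_P closure_subset[of P] that by blast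
      then show ?thesis using l(2) by force
    qed
    then have "l \<bullet> l = 0" by (rule P_zero)
    then show False using l by simp
  qed
  moreover have "polytope P" using assms(1) by (simp add: P_def lattice_polygon_def polytope_convex_hull)
  moreover have "aff_dim P = 2"
    using \<open>0 \<in> interior P\<close> by (subst aff_dim_nonempty_interior) auto
  moreover have "primitive_lattice_point v" if "v extreme_point_of P" for v
  proof -
    have "v \<in> lattice_vector ` V"
      using that unfolding P_def lattice_polygon_def by (rule extreme_point_of_convex_hull)
    then show ?thesis using prim
      by (force simp: primitive_lattice_point_def lattice_vector_def)
  qed
  ultimately show ?thesis by (simp add: Fano_polygon_def P_def)
qed

section \<open>A barycenter criterion\<close>

text \<open>A real linear symmetry \<open>R\<close> of \<open>P\<close> makes the transpose of \<open>R\<close> a symmetry of the dual. As it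
preserves area, it fixes the barycenter of the dual. The condition on the trace says \<open>det (R - 1)
= 2 - trace R \<noteq> 0\<close>, so the only fixed vector is 0. It is essential that \<open>R\<close> may fail to be
integral: this is how a polygon without lattice symmetries can be Kaehler--Einstein.\<close>
lemma Kaehler_Einstein_if_symmetry:
  fixes R :: "real^2^2"
  assumes P: "(*v) R ` P = P" and R: "det R = 1" "trace R \<noteq> 2"
  shows "Kaehler_Einstein P"
proof -
  define S where "S = dual_polygon P"
  define M where "M = transpose R"
  have adj: "(M *v w) \<bullet> v = w \<bullet> (R *v v)" for v w
    by (simp add: M_def inner_2 matrix_vector_mult_def sum_2 transpose_def algebra_simps)
  have dM: "det M = 1" using R by (simp add: M_def)
  then obtain N where N: "M ** N = mat 1"
    using invertible_det_nz[of M] by (auto simp: invertible_def)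
  have S: "(*v) M ` S = S"
  proof
    show "(*v) M ` S \<subseteq> S" 
    proof -
      have "R *v v \<in> P" if "v \<in> P" for v
        using imageI[OF that, of "(*v) R"] unfolding P .
      then show ?thesis by (auto simp: S_def dual_polygon_def adj)
    qed
    show "S \<subseteq> (*v) M ` S"
    proof
      fix w assume w: "w \<in> S"
      have MN: "w = M *v (N *v w)" using N by (simp add: matrix_vector_mul_assoc)
      have "(N *v w) \<bullet> v \<ge> -1" if "v \<in> P" for v
      proof -
        have "v \<in> (*v) R ` P" using that P by simp
        then obtain u where u: "u \<in> P" "v = R *v u" by blast
        then have "(N *v w) \<bullet> v = w \<bullet> u"
          using adj[of "N *v w" u] by (simp flip: MN)
        then show ?thesis using w u by (simp add: S_def dual_polygon_def)
      qed
      then show "w \<in> (*v) M ` S" using MN by (auto simp: S_def dual_polygon_def)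
    qed
  qed
  have fixed: "b = 0" if "M *v b = b" for b
  proof -
    have b: "M$1$1 * b$1 + M$1$2 * b$2 = b$1" "M$2$1 * b$1 + M$2$2 * b$2 = b$2"
      using that by (simp_all add: vec_eq_iff forall_2 matrix_vector_mult_def sum_2)
    define D where "D = (M$1$1 - 1) * (M$2$2 - 1) - M$1$2 * M$2$1"
    have "D = det M - trace M + 1" by (simp add: D_def det_2 trace_def sum_2 algebra_simps)
    moreover have "trace M = trace R" by (simp add: M_def trace_def transpose_def)
    ultimately have "D \<noteq> 0" using dM R by simp
    have "D * b$1 = (M$2$2 - 1) * (M$1$1 * b$1 + M$1$2 * b$2 - b$1) - M$1$2 * (M$2$1 * b$1 + M$2$2 * b$2 - b$2)"
      "D * b$2 = (M$1$1 - 1) * (M$2$1 * b$1 + M$2$2 * b$2 - b$2) - M$2$1 * (M$1$1 * b$1 + M$1$2 * b$2 - b$1)"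
      by (simp_all add: D_def algebra_simps)
    then have "D * b$1 = 0" "D * b$2 = 0" unfolding b by simp_all
    then show ?thesis using \<open>D \<noteq> 0\<close> by (simp add: vec_eq_iff forall_2)
  qed
  have "(LINT x:S|lborel. x) = 0"
  proof (cases "set_integrable lborel S (\<lambda>x. x)")
    case True
    have abs: "(\<lambda>x. x) absolutely_integrable_on S"
      using True unfolding set_integrable_def
      by (rule integrable_completion[THEN iffD2, rotated])
        (use True in \<open>auto simp: set_integrable_def\<close>)
    have lin: "linear ((*v) M)" by (rule matrix_vector_mul_linear)
    define b where "b = integral S (\<lambda>x. x)"
    have int: "(\<lambda>x. x) integrable_on S" "(LINT x:S|lborel. x) = b"
      using set_borel_integral_eq_integral[OF True] by (simp_all add: b_def)
    have "b = integral ((*v) M ` S) (\<lambda>x. x)" by (simp add: S b_def)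
    also have "\<dots> = \<bar>det (matrix ((*v) M))\<bar> *\<^sub>R integral S ((\<lambda>x. x) \<circ> (*v) M)"
      using abs S by (intro integral_change_of_variables_linear lin) auto
    also have "\<dots> = integral S ((*v) M \<circ> (\<lambda>x. x))" using dM by (simp add: o_def)
    also have "\<dots> = M *v b" unfolding b_def
      by (rule integral_linear[OF int(1)]) (rule linear_linear[THEN iffD2, OF lin])
    finally show ?thesis using fixed int by simp
  next
    (* The Bochner integral is 0 by convention when the identity is not integrable. *)
    case False
    then show ?thesis
      by (simp add: set_lebesgue_integral_def set_integrable_def not_integrable_integral_eq)
  qed
  then show ?thesis by (simp add: Kaehler_Einstein_def barycenter_def S_def)
qed

section \<open>Symmetry groups of finite sets of lattice points\<close>
lemma lattice_act_mult: "lattice_act (A ** B) v = lattice_act A (lattice_act B v)"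
  by (simp add: lattice_act_def matrix2 algebra_simps)

lemma lattice_act_one: "lattice_act (mat 1) v = v"
  by (simp add: lattice_act_def matrix2)

lemma subgroup_lattice_symmetries: "subgroup (lattice_symmetries V) GL2Z"
proof (rule subgroup.intro)
  show "lattice_symmetries V \<subseteq> carrier GL2Z" by (auto simp: lattice_symmetries_def)
  show "\<one>\<^bsub>GL2Z\<^esub> \<in> lattice_symmetries V"
    by (simp add: lattice_symmetries_def carrier_GL2Z lattice_act_one)
next
  fix A assume A: "A \<in> lattice_symmetries V"
  define B where "B = inv\<^bsub>GL2Z\<^esub> A"
  have car: "A \<in> carrier GL2Z" using A by (simp add: lattice_symmetries_def)
  have "B ** A = mat 1" using group.l_inv[OF group_GL2Z car] by (simp add: B_def)
  then have "lattice_act B (lattice_act A v) = v" for v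
    by (simp add: lattice_act_one flip: lattice_act_mult)
  then have "lattice_act B ` lattice_act A ` V = V" by (simp add: image_image)
  then have "lattice_act B ` V = V" using A by (simp add: lattice_symmetries_def)
  then show "inv\<^bsub>GL2Z\<^esub> A \<in> lattice_symmetries V"
    using group.inv_closed[OF group_GL2Z car] by (simp add: lattice_symmetries_def B_def)
next
  fix A B assume "A \<in> lattice_symmetries V" "B \<in> lattice_symmetries V"
  moreover have "lattice_act (A ** B) ` V = lattice_act A ` lattice_act B ` V"
    by (simp add: image_image lattice_act_mult)
  ultimately show "A \<otimes>\<^bsub>GL2Z\<^esub> B \<in> lattice_symmetries V"
    by (auto simp: lattice_symmetries_def carrier_GL2Z det_mul)
qed

text \<open>A symmetry is determined by where it sends two independent points of \<open>V\<close>.\<close>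
lemma finite_lattice_symmetries:
  assumes "finite V" "(a, b) \<in> V" "(c, d) \<in> V" "a * d \<noteq> b * c"
  shows "finite_GL2Z_subgroup (lattice_symmetries V)"
proof (rule finite_GL2Z_subgroup.intro)
  define f where "f = (\<lambda>A. (lattice_act A (a, b), lattice_act A (c, d)))"
  have "inj f"
  proof (rule injI)
    fix A B assume "f A = f B"
    then have eqs: "(A$i$1 - B$i$1) * a + (A$i$2 - B$i$2) * b = 0"
      "(A$i$1 - B$i$1) * c + (A$i$2 - B$i$2) * d = 0" for i
      using exhaust_2[of i] by (auto simp: f_def lattice_act_def algebra_simps)
    have "A$i$1 = B$i$1 \<and> A$i$2 = B$i$2" for i
    proof -
      define x y where "x = A$i$1 - B$i$1" "y = A$i$2 - B$i$2"
      have "x * (a * d - b * c) = d * (x * a + y * b) - b * (x * c + y * d)"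
        "y * (a * d - b * c) = a * (x * c + y * d) - c * (x * a + y * b)"
        by (simp_all add: algebra_simps)
      then have "x * (a * d - b * c) = 0" "y * (a * d - b * c) = 0"
        using eqs[of i] by (simp_all add: x_y_def)
      then show ?thesis using assms(4) by (simp add: x_y_def)
    qed
    then show "A = B" by (simp add: vec_eq_iff forall_2)
  qed
  moreover have "f ` lattice_symmetries V \<subseteq> V \<times> V"
    using assms by (auto simp: f_def lattice_symmetries_def)
  then have "finite (f ` lattice_symmetries V)" using assms(1) finite_subset by blast
  ultimately show "finite (lattice_symmetries V)" using finite_imageD inj_on_subset by blast
qed (rule subgroup_lattice_symmetries)

lemma Kaehler_Einstein_lattice_polygon:
  fixes R :: "real^2^2"
  assumes "(\<lambda>v. R *v lattice_vector v) ` V = lattice_vector ` V" "det R = 1" "trace R \<noteq> 2"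
  shows "Kaehler_Einstein (lattice_polygon V)"
proof (rule Kaehler_Einstein_if_symmetry)
  show "(*v) R ` lattice_polygon V = lattice_polygon V"
    unfolding lattice_polygon_def
    by (simp add: convex_hull_linear_image[OF matrix_vector_mul_linear] image_image assms)
qed fact+

section \<open>Three families of Kaehler--Einstein polygons\<close>

text \<open>These are the images of the standard triangle, square and hexagon under the real linear map
that fixes \<open>(1, 0)\<close> and sends \<open>(0, 1)\<close> to \<open>(a, b)\<close>. They inherit the affine geometry of the
standard polygons, but their integral symmetries are only those that the map conjugates to
integral matrices. For the triangle, the rotations of order 3 are integral iff \<open>b\<close> divides \<open>a\<^sup>2 +
a + 1\<close>, and the three reflections iff \<open>b\<close> divides \<open>2 a + 1\<close>, \<open>a\<^sup>2 - 1\<close> and \<open>a (a + 2)\<close>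
respectively. The hexagon is spanned by the triangle and its negative, and its symmetries are
those of the triangle up to sign. For the parallelogram, the rotations of order 4 are integral iff
\<open>b\<close> divides \<open>a\<^sup>2 + 1\<close>, and the reflections iff \<open>b\<close> divides \<open>2 a\<close> (those fixing a vertex) or \<open>a\<^sup>2 -
1\<close> (those mapping an edge to itself).\<close>
definition triangle :: "int \<Rightarrow> int \<Rightarrow> (int \<times> int) set" where
  "triangle a b = {(1, 0), (a, b), (- 1 - a, - b)}"

definition parallelogram :: "int \<Rightarrow> int \<Rightarrow> (int \<times> int) set" where
  "parallelogram a b = {(1, 0), (a, b), (- 1, 0), (- a, - b)}"

definition hexagon :: "int \<Rightarrow> int \<Rightarrow> (int \<times> int) set" where
  "hexagon a b = {(1, 0), (a, b), (- 1 - a, - b), (- 1, 0), (- a, - b), (1 + a, b)}"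

definition Kaehler_Einstein_vertices :: "(int \<times> int) set \<Rightarrow> bool" where
  "Kaehler_Einstein_vertices V \<longleftrightarrow>
    Fano_polygon (lattice_polygon V) \<and> Kaehler_Einstein (lattice_polygon V) \<and>
    Aut_polygon (lattice_polygon V) = lattice_symmetries V \<and>
    finite_GL2Z_subgroup (lattice_symmetries V)"

lemma Kaehler_Einstein_verticesI:
  fixes R :: "real^2^2"
  assumes "finite V" "on_ellipse V" "\<And>x y. (x, y) \<in> V \<Longrightarrow> coprime x y" "(\<Sum>v\<in>V. v) = 0"
    "(1, 0) \<in> V" "(a, b) \<in> V" "b \<noteq> 0"
    "(\<lambda>v. R *v lattice_vector v) ` V = lattice_vector ` V" "det R = 1" "trace R \<noteq> 2"
  shows "Kaehler_Einstein_vertices V"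
  unfolding Kaehler_Einstein_vertices_def
  using assms Fano_lattice_polygon[of V 1 0 a b] Kaehler_Einstein_lattice_polygon[of R V]
    Aut_lattice_polygon[of V] finite_lattice_symmetries[of V 1 0 a b] by auto

lemma hexagonal_form_positive:
  fixes a b :: int
  assumes "b > 0"
  shows "(- ((2 * a + 1) * b))\<^sup>2 < 2 * b\<^sup>2 * (2 * (a\<^sup>2 + a + 1))"
proof -
  have "2 * b\<^sup>2 * (2 * (a\<^sup>2 + a + 1)) = (- ((2 * a + 1) * b))\<^sup>2 + 3 * b\<^sup>2"
    by (simp add: power2_eq_square algebra_simps)
  moreover have "0 < b\<^sup>2" using assms by simp
  ultimately show ?thesis by linarith
qed

text \<open>The matrix \<open>R\<close> permutes the three vertices cyclically, and the ellipse is the one preserved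
by \<open>R\<close>: in the coordinates \<open>X = b x - a y\<close> and \<open>Y = y\<close>, proportional to those with respect to the
basis \<open>(1, 0)\<close>, \<open>(a, b)\<close>, it is \<open>X\<^sup>2 - X Y + Y\<^sup>2 = b\<^sup>2\<close>.\<close>
lemma Kaehler_Einstein_triangle:
  assumes "b > 0" "coprime a b" "coprime (a + 1) b"
  shows "Kaehler_Einstein_vertices (triangle a b)"
proof (rule Kaehler_Einstein_verticesI[where a = a and b = b])
  define R :: "real^2^2" where
    "R = vector [vector [of_int a, - of_int (1 + a + a\<^sup>2) / of_int b], vector [of_int b, - 1 - of_int a]]"
  show "on_ellipse (triangle a b)" unfolding on_ellipse_def
  proof (intro exI conjI)
    show "0 < 2 * b\<^sup>2" "(- ((2 * a + 1) * b))\<^sup>2 < 2 * b\<^sup>2 * (2 * (a\<^sup>2 + a + 1))"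
      using assms(1) hexagonal_form_positive[of b a] by simp_all
    show "\<forall>(x, y)\<in>triangle a b.
       2 * b\<^sup>2 * x\<^sup>2 + 2 * (- ((2 * a + 1) * b)) * x * y + 2 * (a\<^sup>2 + a + 1) * y\<^sup>2 = 2 * b\<^sup>2"
      by (simp add: triangle_def power2_eq_square algebra_simps)
  qed
  have "coprime (- (a + 1)) (- b)"
    using assms(3) by (simp only: coprime_minus_left_iff coprime_minus_right_iff)
  moreover have "- (a + 1) = - 1 - a" by simp
  ultimately have "coprime (- 1 - a) (- b)" by (simp only:)
  then show "coprime x y" if "(x, y) \<in> triangle a b" for x y
    using that assms by (auto simp: triangle_def)
  show "(\<Sum>v\<in>triangle a b. v) = 0" using assms(1) by (simp add: triangle_def zero_prod_def)
  have "R *v lattice_vector (1, 0) = lattice_vector (a, b)"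
    "R *v lattice_vector (a, b) = lattice_vector (- 1 - a, - b)"
    "R *v lattice_vector (- 1 - a, - b) = lattice_vector (1, 0)"
    using assms(1)
    by (simp_all add: R_def vec_eq_iff forall_2 matrix_vector_mult_def sum_2 field_simps power2_eq_square)
  then show "(\<lambda>v. R *v lattice_vector v) ` triangle a b = lattice_vector ` triangle a b"
    by (auto simp: triangle_def)
  show "det R = 1" "trace R \<noteq> 2" using assms(1)
    by (simp_all add: R_def det_2 trace_def sum_2 field_simps power2_eq_square)
qed (use assms in \<open>auto simp: triangle_def\<close>)

text \<open>Here \<open>-1\<close> serves as the symmetry without fixed vectors.\<close>
lemma Kaehler_Einstein_centrally_symmetric:
  assumes "finite V" "on_ellipse V" "\<And>x y. (x, y) \<in> V \<Longrightarrow> coprime x y"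
    "(1, 0) \<in> V" "(a, b) \<in> V" "b \<noteq> 0" and neg: "\<And>v. v \<in> V \<Longrightarrow> - v \<in> V"
  shows "Kaehler_Einstein_vertices V"
proof (rule Kaehler_Einstein_verticesI[where a = a and b = b])
  have image: "uminus ` V = V"
  proof
    show "uminus ` V \<subseteq> V" using neg by blast
    show "V \<subseteq> uminus ` V"
    proof
      fix v assume "v \<in> V"
      then show "v \<in> uminus ` V" by (intro image_eqI[of _ _ "- v"] neg) simp_all
    qed
  qed
  have "(\<Sum>v\<in>V. v) = (\<Sum>v\<in>uminus ` V. v)" using image by simp
  also have "\<dots> = - (\<Sum>v\<in>V. v)" by (subst sum.reindex) (auto simp: sum_negf)
  finally show "(\<Sum>v\<in>V. v) = 0"
    by (auto simp: prod_eq_iff)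
  have "mat (-1) *v lattice_vector v = lattice_vector (- v)" for v
    by (simp add: vec_eq_iff forall_2 matrix_vector_mult_def mat_def sum_2)
  then show "(\<lambda>v. mat (-1) *v lattice_vector v) ` V = lattice_vector ` V"
    using image by (simp add: image_image[of lattice_vector uminus V, symmetric])
  show "det (mat (-1) :: real^2^2) = 1" "trace (mat (-1) :: real^2^2) \<noteq> 2"
    by (simp_all add: det_2 trace_def sum_2 mat_def)
qed (fact assms)+

text \<open>The ellipse is the image of the unit circle under the map that sends the square to the
parallelogram.\<close>
lemma Kaehler_Einstein_parallelogram:
  assumes "b > 0" "coprime a b"
  shows "Kaehler_Einstein_vertices (parallelogram a b)"
proof (rule Kaehler_Einstein_centrally_symmetric[where a = a and b = b])
  show "on_ellipse (parallelogram a b)" unfolding on_ellipse_def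
  proof (intro exI conjI)
    show "0 < b\<^sup>2" "(- (a * b))\<^sup>2 < b\<^sup>2 * (a\<^sup>2 + 1)"
      using assms(1) by (auto simp: power2_eq_square algebra_simps)
    show "\<forall>(x, y)\<in>parallelogram a b. b\<^sup>2 * x\<^sup>2 + 2 * (- (a * b)) * x * y + (a\<^sup>2 + 1) * y\<^sup>2 = b\<^sup>2"
      by (simp add: parallelogram_def power2_eq_square algebra_simps)
  qed
qed (use assms in \<open>auto simp: parallelogram_def\<close>)

lemma Kaehler_Einstein_hexagon:
  assumes "b > 0" "coprime a b" "coprime (a + 1) b"
  shows "Kaehler_Einstein_vertices (hexagon a b)"
proof (rule Kaehler_Einstein_centrally_symmetric[where a = a and b = b])
  show "on_ellipse (hexagon a b)" unfolding on_ellipse_def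
  proof (intro exI conjI)
    show "0 < 2 * b\<^sup>2" "(- ((2 * a + 1) * b))\<^sup>2 < 2 * b\<^sup>2 * (2 * (a\<^sup>2 + a + 1))"
      using assms(1) hexagonal_form_positive[of b a] by simp_all
    show "\<forall>(x, y)\<in>hexagon a b.
       2 * b\<^sup>2 * x\<^sup>2 + 2 * (- ((2 * a + 1) * b)) * x * y + 2 * (a\<^sup>2 + a + 1) * y\<^sup>2 = 2 * b\<^sup>2"
      by (simp add: hexagon_def power2_eq_square algebra_simps)
  qed
  have "coprime (- (a + 1)) (- b)"
    using assms(3) by (simp only: coprime_minus_left_iff coprime_minus_right_iff)
  moreover have "- (a + 1) = - 1 - a" by simp
  ultimately have "coprime (- 1 - a) (- b)" by (simp only:)
  then show "coprime x y" if "(x, y) \<in> hexagon a b" for x y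
    using that assms by (auto simp: hexagon_def add.commute)
qed (use assms in \<open>auto simp: hexagon_def\<close>)

section \<open>All ten symmetry types occur\<close>
lemma symmetry_cases:
  assumes "A \<in> lattice_symmetries V"
  shows "\<And>v. v \<in> V \<Longrightarrow> lattice_act A v \<in> V"
    "A$1$1 * A$2$2 - A$1$2 * A$2$1 = 1 \<or> A$1$1 * A$2$2 - A$1$2 * A$2$1 = -1"
  using assms by (auto simp: lattice_symmetries_def carrier_GL2Z det_2)

lemma lattice_symmetriesI:
  assumes "lattice_act A ` V = V" "det A = 1 \<or> det A = -1"
  shows "A \<in> lattice_symmetries V"
  using assms by (simp add: lattice_symmetries_def carrier_GL2Z)

lemma rotation_traceI:
  assumes L: "\<And>A. A \<in> G \<Longrightarrow> (det A, trace A) \<in> L"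
    and R: "R \<in> G" "det R = 1" "trace R = t" and t: "t \<in> {-2, -1, 0, 1, 2}"
    and "(1, 0) \<in> L \<Longrightarrow> t = 0"
    and "(1, 1) \<in> L \<Longrightarrow> t \<in> {0, 1}"
    and "(1, -1) \<in> L \<Longrightarrow> t \<in> {0, 1, -1}"
    and "(1, -2) \<in> L \<Longrightarrow> t \<noteq> 2"
  shows "rotation_trace G = t"
proof -
  define T where "T = trace ` {A \<in> G. det A = 1}"
  have "t \<in> T" using R by (auto simp: T_def)
  moreover have "(1, x) \<in> L" if "x \<in> T" for x
    using that L by (force simp: T_def)
  then have "0 \<in> T \<Longrightarrow> t = 0" "1 \<in> T \<Longrightarrow> t \<in> {0, 1}" "-1 \<in> T \<Longrightarrow> t \<in> {0, 1, -1}"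
    "-2 \<in> T \<Longrightarrow> t \<noteq> 2"
    using assms(6-9) by blast+
  ultimately show ?thesis
    unfolding rotation_trace_def T_def[symmetric] Let_def using t by auto
qed

lemma has_reflectionI: "W \<in> G \<Longrightarrow> det W = -1 \<Longrightarrow> has_reflection G"
  by (auto simp: has_reflection_def)

text \<open>The triangle without symmetries: 11 divides none of \<open>a\<^sup>2 + a + 1 = 7\<close>, \<open>2 a + 1 = 5\<close>, \<open>a\<^sup>2 -
1 = 3\<close> and \<open>a (a + 2) = 8\<close> for \<open>a = 2\<close>. In this proof and the following ones, listing the possible
images of two or three vertices leaves finitely many linear systems over the integers. Solving
them restricts the pairs of determinant and trace of a symmetry; an explicit matrix shows that the
generating rotation (and the reflection, if any) occurs.\<close>
lemma symmetry_type_triangle_2_11: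
  shows "rotation_trace (lattice_symmetries (triangle 2 11)) = 2" and
  "\<not> has_reflection (lattice_symmetries (triangle 2 11))"
proof -
  have char_vals: "(det A, trace A) \<in> {(1, 2)}"
    if A: "A \<in> lattice_symmetries (triangle 2 11)" for A
    using symmetry_cases(1)[OF A, of "(1, 0)"] symmetry_cases(1)[OF A, of "(2, 11)"]
      symmetry_cases(2)[OF A]
    by (simp add: triangle_def lattice_act_def det_2 trace_def sum_2)
       (elim disjE conjE; simp; (presburger | arith)?)
  show "rotation_trace (lattice_symmetries (triangle 2 11)) = 2"
    by (rule rotation_traceI[OF char_vals lattice_symmetriesI
          [of "vector [vector [1, 0], vector [0, 1]]"]])
       (auto simp: triangle_def lattice_act_def matrix2)
  show "\<not> has_reflection (lattice_symmetries (triangle 2 11))"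
    by (auto simp: has_reflection_def dest!: char_vals)
qed

lemma symmetry_type_triangle_2_5:
  shows "rotation_trace (lattice_symmetries (triangle 2 5)) = 2" and
  "has_reflection (lattice_symmetries (triangle 2 5))"
proof -
  have char_vals: "(det A, trace A) \<in> {(1, 2), (-1, 0)}"
    if A: "A \<in> lattice_symmetries (triangle 2 5)" for A
    using symmetry_cases(1)[OF A, of "(1, 0)"] symmetry_cases(1)[OF A, of "(2, 5)"]
      symmetry_cases(2)[OF A]
    by (simp add: triangle_def lattice_act_def det_2 trace_def sum_2)
       (elim disjE conjE; simp; (presburger | arith)?)
  show "rotation_trace (lattice_symmetries (triangle 2 5)) = 2"
    by (rule rotation_traceI[OF char_vals lattice_symmetriesI
          [of "vector [vector [1, 0], vector [0, 1]]"]])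
       (auto simp: triangle_def lattice_act_def matrix2)
  show "has_reflection (lattice_symmetries (triangle 2 5))"
    by (rule has_reflectionI[OF lattice_symmetriesI[of "vector [vector [1, -1], vector [0, -1]]"]])
       (auto simp: triangle_def lattice_act_def matrix2)
qed

lemma symmetry_type_triangle_2_7:
  shows "rotation_trace (lattice_symmetries (triangle 2 7)) = -1" and
  "\<not> has_reflection (lattice_symmetries (triangle 2 7))"
proof -
  have char_vals: "(det A, trace A) \<in> {(1, 2), (1, -1)}"
    if A: "A \<in> lattice_symmetries (triangle 2 7)" for A
    using symmetry_cases(1)[OF A, of "(1, 0)"] symmetry_cases(1)[OF A, of "(2, 7)"]
      symmetry_cases(2)[OF A]
    by (simp add: triangle_def lattice_act_def det_2 trace_def sum_2)
       (elim disjE conjE; simp; (presburger | arith)?)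
  show "rotation_trace (lattice_symmetries (triangle 2 7)) = -1"
    by (rule rotation_traceI[OF char_vals lattice_symmetriesI
          [of "vector [vector [2, -1], vector [7, -3]]"]])
       (auto simp: triangle_def lattice_act_def matrix2)
  show "\<not> has_reflection (lattice_symmetries (triangle 2 7))"
    by (auto simp: has_reflection_def dest!: char_vals)
qed

lemma symmetry_type_triangle_0_1:
  shows "rotation_trace (lattice_symmetries (triangle 0 1)) = -1" and
  "has_reflection (lattice_symmetries (triangle 0 1))"
proof -
  have char_vals: "(det A, trace A) \<in> {(1, 2), (1, -1), (-1, 0)}"
    if A: "A \<in> lattice_symmetries (triangle 0 1)" for A
    using symmetry_cases(1)[OF A, of "(1, 0)"] symmetry_cases(1)[OF A, of "(0, 1)"]
      symmetry_cases(1)[OF A, of "(-1, -1)"] symmetry_cases(2)[OF A]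
    by (simp add: triangle_def lattice_act_def det_2 trace_def sum_2)
       (elim disjE conjE; simp; (presburger | arith)?)
  show "rotation_trace (lattice_symmetries (triangle 0 1)) = -1"
    by (rule rotation_traceI[OF char_vals lattice_symmetriesI
          [of "vector [vector [0, -1], vector [1, -1]]"]])
       (auto simp: triangle_def lattice_act_def matrix2)
  show "has_reflection (lattice_symmetries (triangle 0 1))"
    by (rule has_reflectionI[OF lattice_symmetriesI[of "vector [vector [1, -1], vector [0, -1]]"]])
       (auto simp: triangle_def lattice_act_def matrix2)
qed

lemma symmetry_type_parallelogram_2_7:
  shows "rotation_trace (lattice_symmetries (parallelogram 2 7)) = -2" and
  "\<not> has_reflection (lattice_symmetries (parallelogram 2 7))"
proof -
  have char_vals: "(det A, trace A) \<in> {(1, 2), (1, -2)}"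
    if A: "A \<in> lattice_symmetries (parallelogram 2 7)" for A
    using symmetry_cases(1)[OF A, of "(1, 0)"] symmetry_cases(1)[OF A, of "(2, 7)"]
      symmetry_cases(2)[OF A]
    by (simp add: parallelogram_def lattice_act_def det_2 trace_def sum_2)
       (elim disjE conjE; simp; (presburger | arith)?)
  show "rotation_trace (lattice_symmetries (parallelogram 2 7)) = -2"
    by (rule rotation_traceI[OF char_vals lattice_symmetriesI
          [of "vector [vector [-1, 0], vector [0, -1]]"]])
       (auto simp: parallelogram_def lattice_act_def matrix2)
  show "\<not> has_reflection (lattice_symmetries (parallelogram 2 7))"
    by (auto simp: has_reflection_def dest!: char_vals)
qed

lemma symmetry_type_parallelogram_1_3:
  shows "rotation_trace (lattice_symmetries (parallelogram 1 3)) = -2" and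
  "has_reflection (lattice_symmetries (parallelogram 1 3))"
proof -
  have char_vals: "(det A, trace A) \<in> {(1, 2), (1, -2), (-1, 0)}"
    if A: "A \<in> lattice_symmetries (parallelogram 1 3)" for A
    using symmetry_cases(1)[OF A, of "(1, 0)"] symmetry_cases(1)[OF A, of "(1, 3)"]
      symmetry_cases(2)[OF A]
    by (simp add: parallelogram_def lattice_act_def det_2 trace_def sum_2)
       (elim disjE conjE; simp; (presburger | arith)?)
  show "rotation_trace (lattice_symmetries (parallelogram 1 3)) = -2"
    by (rule rotation_traceI[OF char_vals lattice_symmetriesI
          [of "vector [vector [-1, 0], vector [0, -1]]"]])
       (auto simp: parallelogram_def lattice_act_def matrix2)
  show "has_reflection (lattice_symmetries (parallelogram 1 3))"
    by (rule has_reflectionI[OF lattice_symmetriesI[of "vector [vector [1, 0], vector [3, -1]]"]])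
       (auto simp: parallelogram_def lattice_act_def matrix2)
qed

lemma symmetry_type_parallelogram_2_5:
  shows "rotation_trace (lattice_symmetries (parallelogram 2 5)) = 0" and
  "\<not> has_reflection (lattice_symmetries (parallelogram 2 5))"
proof -
  have char_vals: "(det A, trace A) \<in> {(1, 2), (1, -2), (1, 0)}"
    if A: "A \<in> lattice_symmetries (parallelogram 2 5)" for A
    using symmetry_cases(1)[OF A, of "(1, 0)"] symmetry_cases(1)[OF A, of "(2, 5)"]
      symmetry_cases(2)[OF A]
    by (simp add: parallelogram_def lattice_act_def det_2 trace_def sum_2)
       (elim disjE conjE; simp; (presburger | arith)?)
  show "rotation_trace (lattice_symmetries (parallelogram 2 5)) = 0"
    by (rule rotation_traceI[OF char_vals lattice_symmetriesI
          [of "vector [vector [2, -1], vector [5, -2]]"]])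
       (auto simp: parallelogram_def lattice_act_def matrix2)
  show "\<not> has_reflection (lattice_symmetries (parallelogram 2 5))"
    by (auto simp: has_reflection_def dest!: char_vals)
qed

lemma symmetry_type_parallelogram_0_1:
  shows "rotation_trace (lattice_symmetries (parallelogram 0 1)) = 0" and
  "has_reflection (lattice_symmetries (parallelogram 0 1))"
proof -
  have char_vals: "(det A, trace A) \<in> {(1, 2), (1, -2), (1, 0), (-1, 0)}"
    if A: "A \<in> lattice_symmetries (parallelogram 0 1)" for A
    using symmetry_cases(1)[OF A, of "(1, 0)"] symmetry_cases(1)[OF A, of "(0, 1)"]
      symmetry_cases(2)[OF A]
    by (simp add: parallelogram_def lattice_act_def det_2 trace_def sum_2)
       (elim disjE conjE; simp; (presburger | arith)?)
  show "rotation_trace (lattice_symmetries (parallelogram 0 1)) = 0"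
    by (rule rotation_traceI[OF char_vals lattice_symmetriesI
          [of "vector [vector [0, -1], vector [1, 0]]"]])
       (auto simp: parallelogram_def lattice_act_def matrix2)
  show "has_reflection (lattice_symmetries (parallelogram 0 1))"
    by (rule has_reflectionI[OF lattice_symmetriesI[of "vector [vector [1, 0], vector [0, -1]]"]])
       (auto simp: parallelogram_def lattice_act_def matrix2)
qed

lemma symmetry_type_hexagon_2_7:
  shows "rotation_trace (lattice_symmetries (hexagon 2 7)) = 1" and
  "\<not> has_reflection (lattice_symmetries (hexagon 2 7))"
proof -
  have char_vals: "(det A, trace A) \<in> {(1, 2), (1, -2), (1, 1), (1, -1)}"
    if A: "A \<in> lattice_symmetries (hexagon 2 7)" for A
    using symmetry_cases(1)[OF A, of "(1, 0)"] symmetry_cases(1)[OF A, of "(2, 7)"]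
      symmetry_cases(2)[OF A]
    by (simp add: hexagon_def lattice_act_def det_2 trace_def sum_2)
       (elim disjE conjE; simp; (presburger | arith)?)
  show "rotation_trace (lattice_symmetries (hexagon 2 7)) = 1"
    by (rule rotation_traceI[OF char_vals lattice_symmetriesI
          [of "vector [vector [-2, 1], vector [-7, 3]]"]])
       (auto simp: hexagon_def lattice_act_def matrix2)
  show "\<not> has_reflection (lattice_symmetries (hexagon 2 7))"
    by (auto simp: has_reflection_def dest!: char_vals)
qed

lemma symmetry_type_hexagon_0_1:
  shows "rotation_trace (lattice_symmetries (hexagon 0 1)) = 1" and
  "has_reflection (lattice_symmetries (hexagon 0 1))"
proof -
  have char_vals: "(det A, trace A) \<in> {(1, 2), (1, -2), (1, 1), (1, -1), (-1, 0)}"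
    if A: "A \<in> lattice_symmetries (hexagon 0 1)" for A
    using symmetry_cases(1)[OF A, of "(1, 0)"] symmetry_cases(1)[OF A, of "(0, 1)"]
      symmetry_cases(1)[OF A, of "(1, 1)"] symmetry_cases(2)[OF A]
    by (simp add: hexagon_def lattice_act_def det_2 trace_def sum_2)
       (elim disjE conjE; simp; (presburger | arith)?)
  show "rotation_trace (lattice_symmetries (hexagon 0 1)) = 1"
    by (rule rotation_traceI[OF char_vals lattice_symmetriesI
          [of "vector [vector [0, 1], vector [-1, 1]]"]])
       (auto simp: hexagon_def lattice_act_def matrix2)
  show "has_reflection (lattice_symmetries (hexagon 0 1))"
    by (rule has_reflectionI[OF lattice_symmetriesI[of "vector [vector [1, -1], vector [0, -1]]"]])
       (auto simp: hexagon_def lattice_act_def matrix2)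
qed

lemma rotation_trace_cases: "rotation_trace G \<in> {2, -2, -1, 0, 1}"
  by (simp add: rotation_trace_def Let_def)

text \<open>The parameters follow the divisibility conditions stated with the three families. For \<open>a =
2\<close>, a triangle has only a reflection if \<open>b = 5\<close> and only rotations if \<open>b = 7\<close>, and a parallelogram
has only rotations if \<open>b = 5\<close> and only \<open>\<plusminus>1\<close> if \<open>b = 7\<close>. The parallelogram with \<open>a = 1\<close> and \<open>b = 3\<close>
has in addition to \<open>\<plusminus>1\<close> the reflections that map an edge to itself. For \<open>a = 0\<close> and \<open>b = 1\<close> all
symmetries of the standard polygons are present.\<close>
lemma all_symmetry_types_realized:
  assumes "t \<in> {2, -2, -1, 0, 1}"
  obtains V where "Kaehler_Einstein_vertices V"
    "rotation_trace (lattice_symmetries V) = t" "has_reflection (lattice_symmetries V) = b"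
proof -
  have coprime: "coprime 2 (11::int)" "coprime 3 (11::int)" "coprime 2 (5::int)" "coprime 3 (5::int)"
    "coprime 2 (7::int)" "coprime 3 (7::int)" "coprime 1 (3::int)" "coprime 0 (1::int)"
    by (simp_all add: coprime_iff_gcd_eq_1 gcd_non_0_int)
  have KE: "Kaehler_Einstein_vertices (triangle 2 11)" "Kaehler_Einstein_vertices (triangle 2 5)"
    "Kaehler_Einstein_vertices (triangle 2 7)" "Kaehler_Einstein_vertices (triangle 0 1)"
    "Kaehler_Einstein_vertices (parallelogram 2 7)" "Kaehler_Einstein_vertices (parallelogram 1 3)"
    "Kaehler_Einstein_vertices (parallelogram 2 5)" "Kaehler_Einstein_vertices (parallelogram 0 1)"
    "Kaehler_Einstein_vertices (hexagon 2 7)" "Kaehler_Einstein_vertices (hexagon 0 1)"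
    using coprime by
      (auto intro!: Kaehler_Einstein_triangle Kaehler_Einstein_parallelogram
        Kaehler_Einstein_hexagon)
  note types = symmetry_type_triangle_2_11 symmetry_type_triangle_2_5 symmetry_type_triangle_2_7
    symmetry_type_triangle_0_1 symmetry_type_parallelogram_2_7 symmetry_type_parallelogram_1_3
    symmetry_type_parallelogram_2_5 symmetry_type_parallelogram_0_1 symmetry_type_hexagon_2_7
    symmetry_type_hexagon_0_1
  have "\<exists>V. Kaehler_Einstein_vertices V \<and> rotation_trace (lattice_symmetries V) = t \<and>
      has_reflection (lattice_symmetries V) = b"
    using assms KE types by (cases b) (elim insertE emptyE; blast)+
  then show ?thesis using that by blast
qed

theorem theorem1p7:
  fixes G :: "(int^2^2) set"
  assumes "subgroup G GL2Z" and "finite G"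
  shows "\<exists>P :: (real^2) set. Fano_polygon P \<and> Kaehler_Einstein P \<and>
           GL2Z\<lparr>carrier := Aut_polygon P\<rparr> \<cong> GL2Z\<lparr>carrier := G\<rparr>"
proof -
  have G: "finite_GL2Z_subgroup G" using assms by (rule finite_GL2Z_subgroup.intro)
  obtain V where V: "Kaehler_Einstein_vertices V"
    "rotation_trace (lattice_symmetries V) = rotation_trace G"
    "has_reflection (lattice_symmetries V) = has_reflection G"
    using all_symmetry_types_realized[OF rotation_trace_cases] by blast
  show ?thesis
    using V(1) isomorphic_of_same_type[OF _ G V(2,3)]
    by (intro exI[of _ "lattice_polygon V"]) (simp add: Kaehler_Einstein_vertices_def)
qed

end
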